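(* Let $\mathcal{M}_{\mathcal{A}},\mathcal{M}_{\mathcal{B}},\mathcal{M}_{\mathcal{C}}$ be mutually commuting von Neumann subalgebras of $\mathcal{B}(\mathcal{H})$ for some Hilbert space $\mathcal{H}$, and let $\tau$ be a network state on $\mathcal{M}_{\mathcal{ABC}}$. For all observables $A_0,A_1\in\mathcal{M}_{\mathcal{A}}$, $B_0,B_1\in\mathcal{M}_{\mathcal{B}}$, $C_0,C_1\in\mathcal{M}_{\mathcal{C}}$, one has $$\mathcal{S}_\tau=\sqrt{|I_\tau|}+\sqrt{|J_\tau|}\le 2\sqrt{2}.$$
   Context: Mutually commuting means that $\mathcal{M}_i\subset\mathcal{M}_j'$ for $i\neq j\in\{\mathcal{A},\mathcal{B},\mathcal{C}\}$, where $'$ denotes the commutant. $\mathcal{M}_{\mathcal{ABC}}=(\mathcal{M}_{\mathcal{A}}\vee\mathcal{M}_{\mathcal{B}}\vee\mathcal{M}_{\mathcal{C}})''$ is the von Neumann algebra generated by the three algebras. This is the ternary mutually-commuting von Neumann algebra model; it is a model of an entanglement swapping network when all states considered are network states. A network state is a state $\tau\in\mathcal{M}_{\mathcal{ABC}}^*$ (a positive normalized linear functional) satisfying the independence condition $\tau(AC)=\tau(A)\tau(C)$ for all $A\in\mathcal{M}_{\mathcal{A}}$, $C\in\mathcal{M}_{\mathcal{C}}$. Observables are of the form $A_x=A_{0|x}-A_{1|x}$, $B_y=B_{0|y}-B_{1|y}$, $C_z=C_{0|z}-C_{1|z}$ with $x,y,z\in\{0,1\}$, where $\{A_{a|x}\}_{a=0,1}$,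 $\{B_{b|y}\}_{b=0,1}$, $\{C_{c|z}\}_{c=0,1}$ are two-outcome POVMs in $\mathcal{M}_{\mathcal{A}}$, $\mathcal{M}_{\mathcal{B}}$, $\mathcal{M}_{\mathcal{C}}$ respectively; equivalently, they are Hermitian elements of the respective algebras with $-I\le A_x,B_y,C_z\le I$. Set $$I_\tau=\tau\bigl((A_0+A_1)B_0(C_0+C_1)\bigr),\qquad J_\tau=\tau\bigl((A_0-A_1)B_1(C_0-C_1)\bigr).$$ *)

theory Defs
  imports "HOL-Analysis.Analysis"
begin

section \<open>Complex Hilbert spaces\<close>

class complex_module = ab_group_add +
  fixes scaleC :: "complex \<Rightarrow> 'a \<Rightarrow> 'a" (infixr "*\<^sub>C" 75)
  assumes scaleC_add_right: "c *\<^sub>C (x + y) = c *\<^sub>C x + c *\<^sub>C y"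
    and scaleC_add_left: "(c + d) *\<^sub>C x = c *\<^sub>C x + d *\<^sub>C x"
    and scaleC_scaleC: "c *\<^sub>C d *\<^sub>C x = (c * d) *\<^sub>C x"
    and scaleC_one: "1 *\<^sub>C x = x"

text \<open>The inner product is antilinear in its first and linear in its second argument.
  The real scalar multiplication and the norm of \<^class>\<open>real_normed_vector\<close> are tied to the
  complex structure, so that the metric, the topology and \<^const>\<open>bounded_linear\<close> are
  those of the complex space.\<close>

class complex_inner = complex_module + real_normed_vector +
  fixes cinner :: "'a \<Rightarrow> 'a \<Rightarrow> complex"
  assumes scaleR_eq_scaleC: "r *\<^sub>R x = complex_of_real r *\<^sub>C x"
    and cinner_commute: "cinner x y = cnj (cinner y x)"
    and cinner_add_right: "cinner x (y + z) = cinner x y + cinner x z"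
    and cinner_scaleC_right: "cinner x (c *\<^sub>C y) = c * cinner x y"
    and cinner_self_nonneg: "cinner x x \<in> \<real>\<^sub>\<ge>\<^sub>0"
    and cinner_self_eq_zero: "cinner x x = 0 \<longleftrightarrow> x = 0"
    and norm_eq_sqrt_cinner: "norm x = sqrt (cmod (cinner x x))"

class complex_hilbert = complex_inner + complete_space


section \<open>Bounded operators\<close>

typedef (overloaded) 'h bop =
    "{f :: 'h::complex_hilbert \<Rightarrow> 'h. bounded_linear f \<and> (\<forall>c x. f (c *\<^sub>C x) = c *\<^sub>C f x)}"
  morphisms bop_apply Abs_bop
  by (intro exI[of _ "\<lambda>x. x"]) (simp add: bounded_linear_ident)

setup_lifting type_definition_bop

lemma scaleC_group_simps:
  fixes x :: "'a::complex_module"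
  shows scaleC_zero_right: "c *\<^sub>C (0::'a) = 0"
    and scaleC_minus_right: "c *\<^sub>C (- x) = - (c *\<^sub>C x)"
    and scaleC_diff_right: "c *\<^sub>C (x - y) = c *\<^sub>C x - c *\<^sub>C y"
proof -
  have zero: "c *\<^sub>C (0::'a) = 0" for c
    using scaleC_add_right[of c "0::'a" 0] by simp
  have minus: "c *\<^sub>C (- z) = - (c *\<^sub>C z)" for z :: 'a
    using scaleC_add_right[of c z "- z"] zero by (simp add: eq_neg_iff_add_eq_0 add.commute)
  show "c *\<^sub>C (0::'a) = 0" "c *\<^sub>C (- x) = - (c *\<^sub>C x)" by (fact zero minus)+
  show "c *\<^sub>C (x - y) = c *\<^sub>C x - c *\<^sub>C y"
    using scaleC_add_right[of c x "- y"] minus by simp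
qed

lemma norm_scaleC:
  fixes x :: "'a::complex_inner"
  shows "norm (c *\<^sub>C x) = cmod c * norm x"
proof -
  have "cinner (c *\<^sub>C x) (c *\<^sub>C x) = c * cnj c * cinner x x"
    by (metis cinner_commute cinner_scaleC_right complex_cnj_mult mult.assoc mult.commute)
  then show ?thesis
    by (simp add: norm_eq_sqrt_cinner norm_mult real_sqrt_mult)
qed

lemma bounded_linear_scaleC: "bounded_linear (\<lambda>x::'a::complex_inner. c *\<^sub>C x)"
  by (rule bounded_linear_intro[where K = "cmod c"])
    (simp_all add: scaleC_add_right scaleR_eq_scaleC scaleC_scaleC norm_scaleC mult.commute)

text \<open>Multiplication of operators is composition and \<open>1\<close> is the identity operator. There is
  no \<^class>\<open>ring_1\<close> instance because \<open>0 = 1\<close> on the zero space.\<close>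

instantiation bop :: (complex_hilbert) "{ring, monoid_mult}"
begin
lift_definition zero_bop :: "'a bop" is "\<lambda>x. 0"
  by (simp add: scaleC_zero_right)
lift_definition one_bop :: "'a bop" is "\<lambda>x. x"
  by (simp add: bounded_linear_ident)
lift_definition plus_bop :: "'a bop \<Rightarrow> 'a bop \<Rightarrow> 'a bop" is "\<lambda>S T x. S x + T x"
  by (simp add: bounded_linear_add scaleC_add_right)
lift_definition uminus_bop :: "'a bop \<Rightarrow> 'a bop" is "\<lambda>T x. - T x"
  by (simp add: bounded_linear_minus scaleC_minus_right)
lift_definition minus_bop :: "'a bop \<Rightarrow> 'a bop \<Rightarrow> 'a bop" is "\<lambda>S T x. S x - T x"
  by (simp add: bounded_linear_sub scaleC_diff_right)
lift_definition times_bop :: "'a bop \<Rightarrow> 'a bop \<Rightarrow> 'a bop" is "\<lambda>S T x. S (T x)"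
  by (simp add: bounded_linear_compose)
instance
  by standard (transfer; simp add: algebra_simps linear_simps)+
end

instantiation bop :: (complex_hilbert) complex_module
begin
lift_definition scaleC_bop :: "complex \<Rightarrow> 'a bop \<Rightarrow> 'a bop" is "\<lambda>c T x. c *\<^sub>C T x"
  by (auto simp: scaleC_scaleC mult.commute
      intro: bounded_linear_compose[OF bounded_linear_scaleC])
instance
  by standard
    (transfer; simp add: scaleC_add_right scaleC_add_left scaleC_scaleC scaleC_one)+
end

definition is_adjoint :: "'h::complex_hilbert bop \<Rightarrow> 'h bop \<Rightarrow> bool" where
  "is_adjoint S T \<longleftrightarrow> (\<forall>x y. cinner (bop_apply S x) y = cinner x (bop_apply T y))"

definition positive_op :: "'h::complex_hilbert bop \<Rightarrow> bool" where
  "positive_op T \<longleftrightarrow> (\<forall>x. cinner x (bop_apply T x) \<in> \<real>\<^sub>\<ge>\<^sub>0)"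


section \<open>Von Neumann algebras\<close>

definition commutant :: "'h::complex_hilbert bop set \<Rightarrow> 'h bop set" where
  "commutant M = {T. \<forall>S\<in>M. T * S = S * T}"

definition unital_star_algebra :: "'h::complex_hilbert bop set \<Rightarrow> bool" where
  "unital_star_algebra M \<longleftrightarrow>
    1 \<in> M \<and>
    (\<forall>S\<in>M. \<forall>T\<in>M. S + T \<in> M \<and> S * T \<in> M) \<and>
    (\<forall>c. \<forall>T\<in>M. c *\<^sub>C T \<in> M) \<and>
    (\<forall>T\<in>M. \<exists>S\<in>M. is_adjoint S T)"

definition von_neumann_algebra :: "'h::complex_hilbert bop set \<Rightarrow> bool" where
  "von_neumann_algebra M \<longleftrightarrow> unital_star_algebra M \<and> commutant (commutant M) = M"

definition mutually_commuting ::
  "'h::complex_hilbert bop set \<Rightarrow> 'h bop set \<Rightarrow> 'h bop set \<Rightarrow> bool" where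
  "mutually_commuting MA MB MC \<longleftrightarrow>
    MA \<subseteq> commutant MB \<and> MB \<subseteq> commutant MA \<and>
    MA \<subseteq> commutant MC \<and> MC \<subseteq> commutant MA \<and>
    MB \<subseteq> commutant MC \<and> MC \<subseteq> commutant MB"

text \<open>The von Neumann algebra generated by three algebras: the bicommutant of the
  *-algebra they generate.\<close>

definition joint_algebra ::
  "'h::complex_hilbert bop set \<Rightarrow> 'h bop set \<Rightarrow> 'h bop set \<Rightarrow> 'h bop set" where
  "joint_algebra MA MB MC =
    commutant (commutant (unital_star_algebra hull (MA \<union> MB \<union> MC)))"


section \<open>States and observables\<close>

text \<open>A functional on \<open>M\<close> is a total function of which only the values on \<open>M\<close> matter.
  Norm continuity is not demanded, as it follows from positivity.\<close>

definition state_on :: "'h::complex_hilbert bop set \<Rightarrow> ('h bop \<Rightarrow> complex) \<Rightarrow> bool" where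
  "state_on M \<tau> \<longleftrightarrow>
    (\<forall>S\<in>M. \<forall>T\<in>M. \<tau> (S + T) = \<tau> S + \<tau> T) \<and>
    (\<forall>c. \<forall>T\<in>M. \<tau> (c *\<^sub>C T) = c * \<tau> T) \<and>
    (\<forall>T\<in>M. positive_op T \<longrightarrow> \<tau> T \<in> \<real>\<^sub>\<ge>\<^sub>0) \<and>
    \<tau> 1 = 1"

definition network_state ::
  "'h::complex_hilbert bop set \<Rightarrow> 'h bop set \<Rightarrow> 'h bop set \<Rightarrow> ('h bop \<Rightarrow> complex) \<Rightarrow> bool" where
  "network_state MA MB MC \<tau> \<longleftrightarrow>
    state_on (joint_algebra MA MB MC) \<tau> \<and>
    (\<forall>A\<in>MA. \<forall>C\<in>MC. \<tau> (A * C) = \<tau> A * \<tau> C)"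

definition povm2 :: "'h::complex_hilbert bop set \<Rightarrow> 'h bop \<Rightarrow> 'h bop \<Rightarrow> bool" where
  "povm2 M E0 E1 \<longleftrightarrow>
    E0 \<in> M \<and> E1 \<in> M \<and> positive_op E0 \<and> positive_op E1 \<and> E0 + E1 = 1"

definition observable :: "'h::complex_hilbert bop set \<Rightarrow> 'h bop \<Rightarrow> bool" where
  "observable M X \<longleftrightarrow> (\<exists>E0 E1. povm2 M E0 E1 \<and> X = E0 - E1)"

end

theory Submission
  imports Defs
begin

text \<open>
  Write \<open>X = A0 + A1\<close>, \<open>X' = A0 - A1\<close>, \<open>Z = C0 + C1\<close> and \<open>Z' = C0 - C1\<close>. Because the three
  algebras commute, \<open>X B0 Z = B0 (X Z)\<close> is a product of two commuting Hermitian elements, and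
  the Cauchy--Schwarz inequality for the state gives
  \<open>\<bar>I\<bar>\<^sup>2 \<le> \<tau>(B0\<^sup>2) \<tau>(X\<^sup>2 Z\<^sup>2) \<le> \<tau>(X\<^sup>2 Z\<^sup>2)\<close>. The squares \<open>X\<^sup>2\<close> and \<open>Z\<^sup>2\<close> again belong to the two
  outer algebras, so the independence condition of a network state turns the last
  term into \<open>\<tau>(X\<^sup>2) \<tau>(Z\<^sup>2)\<close>; likewise \<open>\<bar>J\<bar>\<^sup>2 \<le> \<tau>(X'\<^sup>2) \<tau>(Z'\<^sup>2)\<close>. By the inequality of
  arithmetic and geometric means, \<open>\<bar>I\<bar> \<le> (\<tau>(X\<^sup>2) + \<tau>(Z\<^sup>2)) / 2\<close>, and similarly for \<open>J\<close>
  (\<open>network_correlator_bound\<close>).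

  The two correlators compete, because \<open>X\<^sup>2 + X'\<^sup>2 = 2 (A0\<^sup>2 + A1\<^sup>2) \<le> 4\<close> and similarly for \<open>Z\<close> and \<open>Z'\<close>
  (\<open>square_sum_observables_le\<close>). Therefore
  \<open>\<bar>I\<bar> + \<bar>J\<bar> \<le> (\<tau>(X\<^sup>2) + \<tau>(Z\<^sup>2) + \<tau>(X'\<^sup>2) + \<tau>(Z'\<^sup>2)) / 2 \<le> 4\<close>, and
  \<open>(\<surd>\<bar>I\<bar> + \<surd>\<bar>J\<bar>)\<^sup>2 \<le> 2 (\<bar>I\<bar> + \<bar>J\<bar>) \<le> 8\<close>.

  Self-adjointness of an operator \<open>T\<close> is expressed as \<open>is_adjoint T T\<close>.
\<close>

section \<open>Self-adjoint and positive operators\<close>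

lemma cinner_add_left: "cinner (x + y) z = cinner x z + cinner y z"
  for x y z :: "'a::complex_inner"
  by (metis cinner_add_right cinner_commute complex_cnj_add)

lemma cinner_scaleC_left: "cinner (c *\<^sub>C x) y = cnj c * cinner x y"
  for x y :: "'a::complex_inner"
  by (metis cinner_commute cinner_scaleC_right complex_cnj_mult)

lemma cinner_diff_right: "cinner x (y - z) = cinner x y - cinner x z"
  for x y z :: "'a::complex_inner"
  by (metis add_diff_cancel_right' cinner_add_right diff_add_cancel)

lemma cinner_diff_left: "cinner (x - y) z = cinner x z - cinner y z"
  for x y z :: "'a::complex_inner"
  by (metis cinner_commute cinner_diff_right complex_cnj_diff)

lemma bop_apply_add_arg: "bop_apply T (x + y) = bop_apply T x + bop_apply T y"
  and bop_apply_scaleC_arg: "bop_apply T (c *\<^sub>C x) = c *\<^sub>C bop_apply T x"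
  by (transfer; simp add: linear_simps)+

lemma self_adjoint_add:
  "is_adjoint S S \<Longrightarrow> is_adjoint T T \<Longrightarrow> is_adjoint (S + T) (S + T)"
  by (simp add: is_adjoint_def plus_bop.rep_eq cinner_add_left cinner_add_right)

lemma self_adjoint_diff:
  "is_adjoint S S \<Longrightarrow> is_adjoint T T \<Longrightarrow> is_adjoint (S - T) (S - T)"
  by (simp add: is_adjoint_def minus_bop.rep_eq cinner_diff_left cinner_diff_right)

lemma self_adjoint_scale:
  "is_adjoint T T \<Longrightarrow>
    is_adjoint (complex_of_real t *\<^sub>C T) (complex_of_real t *\<^sub>C T)"
  by (simp add: is_adjoint_def scaleC_bop.rep_eq cinner_scaleC_left cinner_scaleC_right)

lemma self_adjoint_commuting_mult:
  assumes "is_adjoint S S" "is_adjoint T T" "S * T = T * S"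
  shows "is_adjoint (S * T) (S * T)"
  unfolding is_adjoint_def
proof (intro allI)
  fix x y
  have "cinner (bop_apply (S * T) x) y = cinner x (bop_apply (T * S) y)"
    using assms(1,2) by (simp add: is_adjoint_def times_bop.rep_eq)
  then show "cinner (bop_apply (S * T) x) y = cinner x (bop_apply (S * T) y)"
    by (simp only: assms(3))
qed

text \<open>Over the complex numbers a real quadratic form forces symmetry: evaluating the form at
  \<open>x + y\<close> and at \<open>x + i y\<close> recovers the imaginary and the real part of the
  sesquilinear form.\<close>

lemma positive_op_self_adjoint:
  assumes "positive_op T"
  shows "is_adjoint T T"
  unfolding is_adjoint_def
proof (intro allI)
  fix x y
  have real: "Im (cinner v (bop_apply T v)) = 0" for v
    using assms by (simp add: positive_op_def complex_nonneg_Reals_iff)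
  have "Im (cinner x (bop_apply T y)) + Im (cinner y (bop_apply T x)) = 0"
    using real[of "x + y"] real[of x] real[of y]
    by (simp add: bop_apply_add_arg cinner_add_left cinner_add_right)
  moreover have "Re (cinner x (bop_apply T y)) - Re (cinner y (bop_apply T x)) = 0"
    using real[of "x + \<i> *\<^sub>C y"] real[of x] real[of y]
    by (simp add: bop_apply_add_arg bop_apply_scaleC_arg cinner_add_left cinner_add_right
        cinner_scaleC_left cinner_scaleC_right)
  ultimately have "cinner x (bop_apply T y) = cnj (cinner y (bop_apply T x))"
    by (simp add: complex_eq_iff)
  then show "cinner (bop_apply T x) y = cinner x (bop_apply T y)"
    using cinner_commute[of "bop_apply T x" y] by simp
qed

lemma positive_op_sandwich:
  assumes "is_adjoint S S" "positive_op T"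
  shows "positive_op (S * T * S)"
proof -
  have "cinner x (bop_apply (S * T * S) x)
      = cinner (bop_apply S x) (bop_apply T (bop_apply S x))" for x
    using assms(1) by (simp add: is_adjoint_def times_bop.rep_eq)
  then show ?thesis
    using assms(2) by (simp add: positive_op_def)
qed

lemma positive_op_square:
  assumes "is_adjoint S S"
  shows "positive_op (S * S)"
proof -
  have "positive_op 1"
    by (simp add: positive_op_def one_bop.rep_eq cinner_self_nonneg)
  from positive_op_sandwich[OF assms this] show ?thesis by simp
qed

lemma positive_op_add: "positive_op S \<Longrightarrow> positive_op T \<Longrightarrow> positive_op (S + T)"
  by (simp add: positive_op_def plus_bop.rep_eq cinner_add_right complex_nonneg_Reals_iff)


section \<open>Observables\<close>

lemma observable_self_adjoint: "observable M X \<Longrightarrow> is_adjoint X X"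
  by (auto simp: observable_def povm2_def intro: positive_op_self_adjoint self_adjoint_diff)

text \<open>Effects with \<open>E + F = 1\<close> commute, and the defect \<open>1 - (E - F)\<^sup>2\<close> equals \<open>4 E F\<close>.
  Multiplying by \<open>E + F = 1\<close> turns \<open>E F\<close> into \<open>E F E + F E F\<close>, a sum of sandwiches of
  positive operators.\<close>

lemma observable_square_le_one:
  assumes "observable M X"
  shows "positive_op (1 - X * X)"
proof -
  obtain E F where pos: "positive_op E" "positive_op F" and sum: "E + F = 1" and X: "X = E - F"
    using assms by (auto simp: observable_def povm2_def)
  from sum have F: "F = 1 - E"
    by (metis add_diff_cancel_left')
  let ?P = "E * F * E + F * E * F"
  have "1 - X * X = ?P + ?P + ?P + ?P"
    unfolding X F by (simp add: algebra_simps)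
  then show ?thesis
    using pos by (simp add: positive_op_add positive_op_sandwich positive_op_self_adjoint)
qed


section \<open>Commutants and the joint algebra\<close>

lemma scaleC_mult_left: "(c *\<^sub>C S) * T = c *\<^sub>C (S * T)" for S T :: "'h::complex_hilbert bop"
  by transfer simp

lemma scaleC_mult_right: "S * (c *\<^sub>C T) = c *\<^sub>C (S * T)" for S T :: "'h::complex_hilbert bop"
  by transfer simp

lemma commutant_add: "S \<in> commutant N \<Longrightarrow> T \<in> commutant N \<Longrightarrow> S + T \<in> commutant N"
  by (simp add: commutant_def algebra_simps)

lemma commutant_mult: "S \<in> commutant N \<Longrightarrow> T \<in> commutant N \<Longrightarrow> S * T \<in> commutant N"
  unfolding commutant_def by (auto, metis mult.assoc)

lemma commutant_scale: "T \<in> commutant N \<Longrightarrow> c *\<^sub>C T \<in> commutant N"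
  by (simp add: commutant_def scaleC_mult_left scaleC_mult_right)

lemma commutant_diff: "S \<in> commutant N \<Longrightarrow> T \<in> commutant N \<Longrightarrow> S - T \<in> commutant N"
  by (simp add: commutant_def algebra_simps)

lemma commutant_one: "1 \<in> commutant N"
  by (simp add: commutant_def)

lemma algebras_subset_joint_algebra: "MA \<union> MB \<union> MC \<subseteq> joint_algebra MA MB MC"
proof -
  have "MA \<union> MB \<union> MC \<subseteq> unital_star_algebra hull (MA \<union> MB \<union> MC)"
    by (rule hull_subset)
  moreover have "M \<subseteq> commutant (commutant M)" for M :: "'a bop set"
    by (auto simp: commutant_def)
  ultimately show ?thesis
    unfolding joint_algebra_def by blast
qed

lemma von_neumann_algebra_closed:
  assumes "von_neumann_algebra M" "S \<in> M" "T \<in> M"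
  shows "S + T \<in> M" "S - T \<in> M" "S * T \<in> M"
  using assms commutant_add commutant_diff commutant_mult
  unfolding von_neumann_algebra_def by metis+

lemma observable_mem:
  assumes "von_neumann_algebra M" "observable M X"
  shows "X \<in> M"
  using assms von_neumann_algebra_closed(2) by (auto simp: observable_def povm2_def)


section \<open>States\<close>

text \<open>The algebra is presented as a commutant: this supplies the closure properties that the
  estimates use, and every joint algebra has this form.\<close>

locale operator_state =
  fixes N :: "'h::complex_hilbert bop set" and \<tau> :: "'h bop \<Rightarrow> complex"
  assumes state: "state_on (commutant N) \<tau>"
begin

lemma add: "S \<in> commutant N \<Longrightarrow> T \<in> commutant N \<Longrightarrow> \<tau> (S + T) = \<tau> S + \<tau> T"
  and scale: "T \<in> commutant N \<Longrightarrow> \<tau> (c *\<^sub>C T) = c * \<tau> T"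
  and one: "\<tau> 1 = 1"
  using state by (auto simp: state_on_def)

lemma nonneg: "T \<in> commutant N \<Longrightarrow> positive_op T \<Longrightarrow> 0 \<le> Re (\<tau> T) \<and> Im (\<tau> T) = 0"
  using state by (auto simp: state_on_def complex_nonneg_Reals_iff)

lemma diff: "S \<in> commutant N \<Longrightarrow> T \<in> commutant N \<Longrightarrow> \<tau> (S - T) = \<tau> S - \<tau> T"
  using add[of "S - T" T] commutant_diff[of S N T] by simp

lemma square_nonneg:
  assumes "T \<in> commutant N" "is_adjoint T T"
  shows "0 \<le> Re (\<tau> (T * T))" "Im (\<tau> (T * T)) = 0"
  using nonneg[of "T * T"] assms by (simp_all add: commutant_mult positive_op_square)

text \<open>The squares of \<open>S + T\<close> and \<open>S - T\<close> are nonnegative under the state and differ by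
  \<open>4 S T\<close>. Hence \<open>\<tau>(S T)\<close> is real, and its size is controlled from both sides.\<close>

lemma commuting_product_real:
  assumes mem: "S \<in> commutant N" "T \<in> commutant N"
    and sa: "is_adjoint S S" "is_adjoint T T" and comm: "S * T = T * S"
  shows "Im (\<tau> (S * T)) = 0"
    and "2 * \<bar>Re (\<tau> (S * T))\<bar> \<le> Re (\<tau> (S * S)) + Re (\<tau> (T * T))"
proof -
  have prods: "S * S \<in> commutant N" "S * T \<in> commutant N" "T * T \<in> commutant N"
    using mem by (simp_all add: commutant_mult)
  have "(S + T) * (S + T) = (S * S + T * T) + (S * T + S * T)"
    using comm by (simp add: algebra_simps)
  then have plus: "\<tau> ((S + T) * (S + T)) = \<tau> (S * S) + \<tau> (T * T) + 2 * \<tau> (S * T)"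
    using prods by (simp add: add commutant_add)
  have "(S - T) * (S - T) = (S * S + T * T) - (S * T + S * T)"
    using comm by (simp add: algebra_simps)
  then have minus: "\<tau> ((S - T) * (S - T)) = \<tau> (S * S) + \<tau> (T * T) - 2 * \<tau> (S * T)"
    using prods by (simp add: add diff commutant_add)
  note sq_plus = square_nonneg[OF commutant_add[OF mem] self_adjoint_add[OF sa]]
  note sq_minus = square_nonneg[OF commutant_diff[OF mem] self_adjoint_diff[OF sa]]
  note sq = square_nonneg[OF mem(1) sa(1)] square_nonneg[OF mem(2) sa(2)]
  show "Im (\<tau> (S * T)) = 0"
    using sq_plus(2) sq unfolding plus by simp
  show "2 * \<bar>Re (\<tau> (S * T))\<bar> \<le> Re (\<tau> (S * S)) + Re (\<tau> (T * T))"
    using sq_plus(1) sq_minus(1) unfolding plus minus by simp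
qed

text \<open>Rescaling \<open>T\<close> makes the preceding estimate a quadratic inequality in the scaling
  parameter; its discriminant is the Cauchy--Schwarz inequality.\<close>

lemma Cauchy_Schwarz_commuting:
  assumes mem: "S \<in> commutant N" "T \<in> commutant N"
    and sa: "is_adjoint S S" "is_adjoint T T" and comm: "S * T = T * S"
  shows "(cmod (\<tau> (S * T)))\<^sup>2 \<le> Re (\<tau> (S * S)) * Re (\<tau> (T * T))"
proof -
  let ?s = "Re (\<tau> (S * S))" and ?d = "Re (\<tau> (T * T))" and ?c = "\<bar>Re (\<tau> (S * T))\<bar>"
  have quad: "2 * t * ?c \<le> ?s + t\<^sup>2 * ?d" if "t \<ge> 0" for t
  proof -
    let ?U = "complex_of_real t *\<^sub>C T"
    have ST: "\<tau> (S * ?U) = t * \<tau> (S * T)"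
      using mem by (simp add: scaleC_mult_right scale commutant_mult)
    have TT: "\<tau> (?U * ?U) = t\<^sup>2 * \<tau> (T * T)"
      using mem
      by (simp add: scaleC_mult_right scaleC_mult_left scaleC_scaleC scale commutant_mult
          power2_eq_square flip: of_real_mult)
    have "2 * \<bar>Re (\<tau> (S * ?U))\<bar> \<le> ?s + Re (\<tau> (?U * ?U))"
      by (rule commuting_product_real(2))
        (simp_all add: mem sa self_adjoint_scale commutant_scale scaleC_mult_left
          scaleC_mult_right comm)
    then show ?thesis
      unfolding ST TT using that by (simp add: abs_mult flip: of_real_power)
  qed
  have nn: "0 \<le> ?s" "0 \<le> ?d"
    using square_nonneg mem sa by auto
  have "?c\<^sup>2 \<le> ?s * ?d"
  proof (cases "?d = 0")
    case True
    have "?c = 0"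
    proof (rule ccontr)
      assume "?c \<noteq> 0"
      then have "?c > 0" by linarith
      (* Without a quadratic term, any t beyond ?s / (2 * ?c) contradicts the bound. *)
      moreover from this nn have "2 * ((?s + 1) / (2 * ?c)) * ?c \<le> ?s"
        using quad[of "(?s + 1) / (2 * ?c)"] True by simp
      ultimately show False by simp
    qed
    then show ?thesis using True by simp
  next
    case False
    then have d: "?d > 0" using nn by linarith
    (* t = ?c / ?d minimises ?s - 2 t ?c + t^2 ?d. *)
    then have "2 * (?c / ?d) * ?c \<le> ?s + (?c / ?d)\<^sup>2 * ?d"
      by (intro quad) simp
    then show ?thesis
      using d by (simp add: power2_eq_square field_simps)
  qed
  moreover have "cmod (\<tau> (S * T)) = ?c"
    using commuting_product_real(1)[OF assms] by (simp add: cmod_eq_Re)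
  ultimately show ?thesis by simp
qed

lemma observable_square_le:
  assumes "X \<in> commutant N" "observable M X"
  shows "Re (\<tau> (X * X)) \<le> 1"
proof -
  have "0 \<le> Re (\<tau> (1 - X * X))"
    using nonneg[of "1 - X * X"] assms observable_square_le_one[of M X]
    by (simp add: commutant_diff commutant_one commutant_mult)
  then show ?thesis
    using assms by (simp add: diff commutant_one commutant_mult one)
qed

text \<open>The parallelogram identity makes the squares of sum and difference share a fixed
  budget; this trade-off is the source of the factor \<open>\<surd>2\<close>.\<close>

lemma square_sum_observables_le:
  assumes mem: "X \<in> commutant N" "Y \<in> commutant N" and obs: "observable M X" "observable M Y"
  shows "Re (\<tau> ((X + Y) * (X + Y))) + Re (\<tau> ((X - Y) * (X - Y))) \<le> 4"
proof -
  have "(X + Y) * (X + Y) + (X - Y) * (X - Y) = (X * X + X * X) + (Y * Y + Y * Y)"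
    by (simp add: algebra_simps)
  then have "\<tau> ((X + Y) * (X + Y) + (X - Y) * (X - Y))
      = \<tau> ((X * X + X * X) + (Y * Y + Y * Y))"
    by (rule arg_cong)
  then have "\<tau> ((X + Y) * (X + Y)) + \<tau> ((X - Y) * (X - Y))
      = (\<tau> (X * X) + \<tau> (X * X)) + (\<tau> (Y * Y) + \<tau> (Y * Y))"
    by (simp only: add mem commutant_add commutant_diff commutant_mult)
  from arg_cong[OF this, of Re]
  have "Re (\<tau> ((X + Y) * (X + Y))) + Re (\<tau> ((X - Y) * (X - Y)))
      = 2 * Re (\<tau> (X * X)) + 2 * Re (\<tau> (Y * Y))"
    by simp
  then show ?thesis
    using observable_square_le[OF mem(1) obs(1)] observable_square_le[OF mem(2) obs(2)] by simp
qed

end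


section \<open>The network inequality\<close>

text \<open>Commutation lets the middle observable be split off by Cauchy--Schwarz, and independence
  then factorises what remains. The geometric mean is relaxed to the arithmetic mean because the
  quantities on the right are later bounded through their sums.\<close>

lemma network_correlator_bound:
  assumes vA: "von_neumann_algebra MA" and vC: "von_neumann_algebra MC"
    and comm: "mutually_commuting MA MB MC" and net: "network_state MA MB MC \<tau>"
    and X: "X \<in> MA" "is_adjoint X X" and Z: "Z \<in> MC" "is_adjoint Z Z"
    and B: "B \<in> MB" "observable MB B"
  shows "cmod (\<tau> (X * B * Z)) \<le> (Re (\<tau> (X * X)) + Re (\<tau> (Z * Z))) / 2"
proof -
  define N where "N = commutant (unital_star_algebra hull (MA \<union> MB \<union> MC))"
  have joint: "joint_algebra MA MB MC = commutant N"
    by (simp add: joint_algebra_def N_def)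
  interpret operator_state N \<tau>
    using net by unfold_locales (simp add: network_state_def joint)
  have mem: "X \<in> commutant N" "B \<in> commutant N" "Z \<in> commutant N"
    using algebras_subset_joint_algebra[of MA MB MC] X Z B by (auto simp: joint)
  have XB: "X * B = B * X" and XZ: "X * Z = Z * X" and BZ: "B * Z = Z * B"
    using comm X Z B by (auto simp: mutually_commuting_def commutant_def)
  have "B * (X * Z) = (B * X) * Z"
    by (simp only: mult.assoc)
  also have "\<dots> = X * (B * Z)"
    by (simp only: XB[symmetric] mult.assoc)
  also have "\<dots> = X * Z * B"
    by (simp only: BZ mult.assoc)
  finally have B_XZ: "B * (X * Z) = X * Z * B" .
  have am_gm: "p * q \<le> ((p + q) / 2)\<^sup>2" for p q :: real
    using zero_le_power2[of "p - q"] by (simp add: power2_eq_square field_simps)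
  let ?p = "Re (\<tau> (X * X))" and ?q = "Re (\<tau> (Z * Z))"
  note p = square_nonneg[OF mem(1) X(2)] and q = square_nonneg[OF mem(3) Z(2)]
  have "X * Z * (X * Z) = X * (Z * X) * Z"
    by (simp only: mult.assoc)
  also have "\<dots> = X * X * (Z * Z)"
    by (simp only: XZ[symmetric] mult.assoc)
  finally have "\<tau> (X * Z * (X * Z)) = \<tau> (X * X * (Z * Z))"
    by (rule arg_cong)
  also have "\<dots> = \<tau> (X * X) * \<tau> (Z * Z)"
    using net von_neumann_algebra_closed(3)[OF vA X(1) X(1)]
      von_neumann_algebra_closed(3)[OF vC Z(1) Z(1)]
    by (simp add: network_state_def)
  finally have "\<tau> (X * Z * (X * Z)) = \<tau> (X * X) * \<tau> (Z * Z)" .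
  then have factor: "Re (\<tau> (X * Z * (X * Z))) = ?p * ?q"
    using p q by simp
  have "(cmod (\<tau> (X * B * Z)))\<^sup>2 = (cmod (\<tau> (B * (X * Z))))\<^sup>2"
    by (simp only: XB mult.assoc)
  also have "\<dots> \<le> Re (\<tau> (B * B)) * Re (\<tau> (X * Z * (X * Z)))"
    by (rule Cauchy_Schwarz_commuting[OF mem(2) commutant_mult[OF mem(1,3)]
          observable_self_adjoint[OF B(2)] self_adjoint_commuting_mult[OF X(2) Z(2) XZ] B_XZ])
  also have "\<dots> \<le> 1 * (?p * ?q)"
    unfolding factor
    by (intro mult_right_mono observable_square_le[OF mem(2) B(2)] mult_nonneg_nonneg p q)
  also have "\<dots> \<le> ((?p + ?q) / 2)\<^sup>2"
    using am_gm by simp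
  finally show ?thesis
    by (rule power2_le_imp_le) (use p q in simp)
qed

theorem theorem3p1:
  fixes MA MB MC :: "'h::complex_hilbert bop set"
    and \<tau> :: "'h bop \<Rightarrow> complex"
    and A0 A1 B0 B1 C0 C1 :: "'h bop"
  assumes "von_neumann_algebra MA" and "von_neumann_algebra MB" and "von_neumann_algebra MC"
    and "mutually_commuting MA MB MC"
    and "network_state MA MB MC \<tau>"
    and "observable MA A0" and "observable MA A1"
    and "observable MB B0" and "observable MB B1"
    and "observable MC C0" and "observable MC C1"
  shows "sqrt (cmod (\<tau> ((A0 + A1) * B0 * (C0 + C1))))
       + sqrt (cmod (\<tau> ((A0 - A1) * B1 * (C0 - C1)))) \<le> 2 * sqrt 2"
proof -
  define N where "N = commutant (unital_star_algebra hull (MA \<union> MB \<union> MC))"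
  have joint: "joint_algebra MA MB MC = commutant N"
    by (simp add: joint_algebra_def N_def)
  interpret operator_state N \<tau>
    using assms(5) by unfold_locales (simp add: network_state_def joint)
  have A: "A0 \<in> MA" "A1 \<in> MA" and B: "B0 \<in> MB" "B1 \<in> MB" and C: "C0 \<in> MC" "C1 \<in> MC"
    using assms by (auto intro: observable_mem)
  have mem: "A0 \<in> commutant N" "A1 \<in> commutant N" "C0 \<in> commutant N" "C1 \<in> commutant N"
    using algebras_subset_joint_algebra[of MA MB MC] A C by (auto simp: joint)
  have sa: "is_adjoint A0 A0" "is_adjoint A1 A1" "is_adjoint C0 C0" "is_adjoint C1 C1"
    using assms by (auto intro: observable_self_adjoint)
  let ?I = "cmod (\<tau> ((A0 + A1) * B0 * (C0 + C1)))"
  let ?J = "cmod (\<tau> ((A0 - A1) * B1 * (C0 - C1)))"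
  have I: "?I \<le> (Re (\<tau> ((A0 + A1) * (A0 + A1))) + Re (\<tau> ((C0 + C1) * (C0 + C1)))) / 2"
    using assms A B C sa
    by (intro network_correlator_bound[of MA MC MB])
      (simp_all add: von_neumann_algebra_closed self_adjoint_add)
  have J: "?J \<le> (Re (\<tau> ((A0 - A1) * (A0 - A1))) + Re (\<tau> ((C0 - C1) * (C0 - C1)))) / 2"
    using assms A B C sa
    by (intro network_correlator_bound[of MA MC MB])
      (simp_all add: von_neumann_algebra_closed self_adjoint_diff)
  have budget: "i + j \<le> 4"
    if "i \<le> (p + q) / 2" "j \<le> (p' + q') / 2" "p + p' \<le> 4" "q + q' \<le> 4"
    for i j p p' q q' :: real
    using that by (simp add: field_simps)
  have "?I + ?J \<le> 4"
    by (rule budget[OF I J square_sum_observables_le[OF mem(1,2) assms(6,7)]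
          square_sum_observables_le[OF mem(3,4) assms(10,11)]])
  moreover have "(sqrt ?I + sqrt ?J)\<^sup>2 \<le> 2 * (?I + ?J)"
    using sum_squares_bound[of "sqrt ?I" "sqrt ?J"] by (simp add: power2_sum)
  ultimately have "(sqrt ?I + sqrt ?J)\<^sup>2 \<le> (2 * sqrt 2)\<^sup>2"
    by (simp add: power_mult_distrib)
  then show ?thesis
    by (rule power2_le_imp_le) simp
qed

end
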